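(* Consider the Round-Robin protocol with $n$ agents over a finite item set $M$, as described in the context. Let $i$ be an agent with a normalized, nonnegative, monotone submodular objective $f_i$ and a cardinality constraint $\mathcal{I}_i=\{S\subseteq M:|S|\le k\}$, who follows the greedy policy, ending with set $S_i$. Let $j\neq i$ be any other agent (following an arbitrary policy), let $S_j$ be the set of items selected by agent $j$, and let $g$ be the first item selected by $j$. Define $S'_j=S_j$ if $i<j$ and $S'_j=S_j\setminus\{g\}$ otherwise. Then $f_i(S_i)\ge 0.5\max_{S\in\mathcal{I}_i|S'_j} f_i(S)$.
   Context: For $f:2^M\to\mathbb{R}$ write $f(x\,|\,S)=f(S\cup\{x\})-f(S)$; submodular means $f(x\,|\,S)\ge f(x\,|\,T)$ for $S\subseteq T$, $x\notin T$. For $A\subseteq M$, $\mathcal{I}|A=\{X\cap A: X\in\mathcal{I}\}$. Round-Robin protocol: $|M|=m$; initially the available set is $Q=M$; for rounds $r=1,\dots,\lceil m/n\rceil$ and within each round for agents $1,\dots,n$ in order, the current agent (by an arbitrary policy possibly using full information) either selects one item of $Q$, which is removed from $Q$, or selects nothing. Greedy policy of agent $i$: maintain $S_i$ (initially $\emptyset$); at each turn let $A=\{x\in Q: S_i\cup\{x\}\in\mathcal{I}_i\}$; if $A\neq\emptyset$ select some $j\in\arg\max_{x\in A}f_i(x\,|\,S_i)$ and add it to $S_i$, otherwise select nothing. *)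

theory Defs
  imports Complex_Main
begin

definition marginal :: "('a set \<Rightarrow> real) \<Rightarrow> 'a set \<Rightarrow> 'a \<Rightarrow> real" where
  "marginal f S x = f (S \<union> {x}) - f S"

definition submodular_on :: "'a set \<Rightarrow> ('a set \<Rightarrow> real) \<Rightarrow> bool" where
  "submodular_on M f \<longleftrightarrow>
    (\<forall>S T x. S \<subseteq> T \<and> T \<subseteq> M \<and> x \<in> M \<and> x \<notin> T \<longrightarrow> marginal f S x \<ge> marginal f T x)"

definition cardinality_constraint :: "'a set \<Rightarrow> nat \<Rightarrow> 'a set set" where
  "cardinality_constraint M k = {S. S \<subseteq> M \<and> card S \<le> k}"

definition constraint_restrict :: "'a set set \<Rightarrow> 'a set \<Rightarrow> 'a set set" where
  "constraint_restrict I A = {X \<inter> A |X. X \<in> I}"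

text \<open>An execution of the protocol is recorded as a function \<open>c\<close>: \<open>c r a\<close> is the item selected by
  agent \<open>a\<close> in round \<open>r\<close>, or \<open>None\<close> if that agent selects nothing on that turn. Rounds and agents
  are both numbered from 1; values of \<open>c\<close> outside these ranges are never consulted. Policies are
  arbitrary and may use full information (and may break ties arbitrarily), so the executions that
  can arise are exactly those in which every selected item is available when it is selected.\<close>

type_synonym 'a execution = "nat \<Rightarrow> nat \<Rightarrow> 'a option"

definition num_rounds :: "'a set \<Rightarrow> nat \<Rightarrow> nat" where
  "num_rounds M n = nat \<lceil>real (card M) / real n\<rceil>"

definition available :: "'a set \<Rightarrow> nat \<Rightarrow> 'a execution \<Rightarrow> nat \<Rightarrow> nat \<Rightarrow> 'a set" where
  "available M n c r a =
    M - {x. \<exists>r' a'. 1 \<le> r' \<and> a' \<in> {1..n} \<and> (r' < r \<or> r' = r \<and> a' < a) \<and> c r' a' = Some x}"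

definition round_robin :: "'a set \<Rightarrow> nat \<Rightarrow> 'a execution \<Rightarrow> bool" where
  "round_robin M n c \<longleftrightarrow>
    (\<forall>r\<in>{1..num_rounds M n}. \<forall>a\<in>{1..n}. \<forall>x. c r a = Some x \<longrightarrow> x \<in> available M n c r a)"

definition selected_before :: "'a execution \<Rightarrow> nat \<Rightarrow> nat \<Rightarrow> 'a set" where
  "selected_before c a r = {x. \<exists>r'. 1 \<le> r' \<and> r' < r \<and> c r' a = Some x}"

definition selected :: "'a set \<Rightarrow> nat \<Rightarrow> 'a execution \<Rightarrow> nat \<Rightarrow> 'a set" where
  "selected M n c a = {x. \<exists>r\<in>{1..num_rounds M n}. c r a = Some x}"

text \<open>The value is irrelevant when agent \<open>a\<close> never selects an item.\<close>

definition first_selected :: "'a set \<Rightarrow> nat \<Rightarrow> 'a execution \<Rightarrow> nat \<Rightarrow> 'a" where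
  "first_selected M n c a = the (c (LEAST r. r \<in> {1..num_rounds M n} \<and> c r a \<noteq> None) a)"

definition follows_greedy ::
  "'a set \<Rightarrow> nat \<Rightarrow> ('a set \<Rightarrow> real) \<Rightarrow> 'a set set \<Rightarrow> 'a execution \<Rightarrow> nat \<Rightarrow> bool" where
  "follows_greedy M n f I c i \<longleftrightarrow>
    (\<forall>r\<in>{1..num_rounds M n}.
      let S = selected_before c i r;
          A = {x \<in> available M n c r i. S \<union> {x} \<in> I}
      in if A \<noteq> {} then \<exists>x. c r i = Some x \<and> is_arg_max (marginal f S) (\<lambda>y. y \<in> A) x
         else c r i = None)"

end

theory Submission
  imports Defs
begin

text \<open>Let \<open>S \<subseteq> S'\<^sub>j\<close> with \<open>card S \<le> k\<close>. Every \<open>x \<in> S\<close> is still available to agent \<open>i\<close> at \<open>i\<close>'s last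
  turn before \<open>j\<close> takes \<open>x\<close>; dropping \<open>g\<close> ensures that this turn exists when \<open>j\<close> precedes \<open>i\<close>.
  Charge the \<open>l\<close>-th item of \<open>S\<close>, in the order of selection, to round \<open>l \<le> k\<close>. In that round \<open>i\<close> holds
  fewer than \<open>k\<close> items and the charged item is available, so \<open>i\<close> selects something at least as good.
  Summing over \<open>S\<close> and telescoping gives \<open>f (S \<union> S\<^sub>i) - f S\<^sub>i \<le> f S\<^sub>i\<close>, by submodularity.\<close>

text \<open>Insert the elements of \<open>B\<close> one at a time: by diminishing returns, each gain
  is at most the gain of the same element over \<open>A\<close> alone.\<close>

lemma submodular_on_union_le:
  assumes "submodular_on M f" "finite B" "A \<subseteq> M" "B \<subseteq> M" "A \<inter> B = {}"
  shows "f (A \<union> B) - f A \<le> (\<Sum>x\<in>B. marginal f A x)"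
  using assms(2,4,5)
proof (induction B)
  case empty
  then show ?case by simp
next
  case (insert x B)
  have "marginal f (A \<union> B) x \<le> marginal f A x"
    using assms(1,3) insert.prems insert.hyps unfolding submodular_on_def by auto
  then show ?case
    using insert by (simp add: marginal_def)
qed

text \<open>Replaces turns by ranks in the order of \<open>t\<close>. A rank is no later than the
  turn, so the item is still on offer, and it is at most \<open>card S\<close>, so the capacity is
  not yet exhausted.\<close>

lemma rank_below_injection:
  fixes t :: "'a \<Rightarrow> nat"
  assumes "finite S" "inj_on t S" "\<And>x. x \<in> S \<Longrightarrow> 1 \<le> t x"
  obtains p where "inj_on p S" "\<And>x. x \<in> S \<Longrightarrow> 1 \<le> p x \<and> p x \<le> card S \<and> p x \<le> t x"
proof
  define p where "p x = card {y \<in> S. t y \<le> t x}" for x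
  have less: "p x < p y" if "x \<in> S" "y \<in> S" "t x < t y" for x y
    unfolding p_def using that assms(1) by (intro psubset_card_mono) force+
  show "inj_on p S"
    by (rule inj_onI) (metis assms(2) inj_onD less less_irrefl nat_neq_iff)
  fix x assume x: "x \<in> S"
  \<comment> \<open>The elements counted by \<open>p x\<close> have distinct values of
    \<open>t\<close> in \<open>{1..t x}\<close>.\<close>
  have "p x = card (t ` {y \<in> S. t y \<le> t x})"
    unfolding p_def using assms(2) by (subst card_image) (auto intro: inj_on_subset)
  also have "\<dots> \<le> card {1..t x}"
    using assms(3) by (intro card_mono) auto
  finally have "p x \<le> t x" by simp
  moreover have "0 < p x"
    unfolding p_def using x assms(1) by (auto simp: card_gt_0_iff)
  moreover have "p x \<le> card S"
    unfolding p_def using assms(1) by (intro card_mono) auto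
  ultimately show "1 \<le> p x \<and> p x \<le> card S \<and> p x \<le> t x" by simp
qed

lemma available_earlier_turn:
  assumes "x \<in> available M n c r' a'" "r < r' \<or> r = r' \<and> a \<le> a'"
  shows "x \<in> available M n c r a"
  using assms unfolding available_def by auto

lemma selected_subset:
  assumes "round_robin M n c" "a \<in> {1..n}"
  shows "selected M n c a \<subseteq> M"
  using assms unfolding selected_def round_robin_def available_def by blast

lemma selected_before_subset_selected:
  "r \<le> Suc (num_rounds M n) \<Longrightarrow> selected_before c a r \<subseteq> selected M n c a"
  unfolding selected_before_def selected_def by force

lemma selected_before_num_rounds:
  "selected_before c a (Suc (num_rounds M n)) = selected M n c a"
  unfolding selected_before_def selected_def by force

lemma selected_before_mono:
  "r \<le> r' \<Longrightarrow> selected_before c a r \<subseteq> selected_before c a r'"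
  unfolding selected_before_def by auto

lemma selected_before_Suc:
  assumes "c r a = Some y" "1 \<le> r"
  shows "selected_before c a (Suc r) = selected_before c a r \<union> {y}"
  using assms unfolding selected_before_def by (auto simp: less_Suc_eq)

text \<open>At most one item is gained per round. The bound \<open>r - 1\<close> leaves room for one
  more item in each of the rounds 1 to \<open>k\<close>.\<close>

lemma selected_before_finite_card:
  "finite (selected_before c a r) \<and> card (selected_before c a r) \<le> r - 1"
proof -
  have sub: "selected_before c a r \<subseteq> (\<lambda>r'. the (c r' a)) ` {1..<r}"
    unfolding selected_before_def by force
  then have "card (selected_before c a r) \<le> card {1..<r}"
    by (meson card_image_le card_mono finite_atLeastLessThan finite_imageI le_trans)
  with sub show ?thesis by (auto intro: finite_subset)
qed

lemma selected_disjoint: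
  assumes "round_robin M n c" "a \<in> {1..n}" "b \<in> {1..n}" "a \<noteq> b"
  shows "selected M n c a \<inter> selected M n c b = {}"
proof (rule ccontr)
  assume "\<not> ?thesis"
  then obtain x r s where r: "r \<in> {1..num_rounds M n}" "c r a = Some x"
    and s: "s \<in> {1..num_rounds M n}" "c s b = Some x"
    unfolding selected_def by blast
  have "x \<in> available M n c r a" "x \<in> available M n c s b"
    using assms r s unfolding round_robin_def by blast+
  \<comment> \<open>Of two turns that select \<open>x\<close>, the later would find \<open>x\<close>
    already removed.\<close>
  then have "\<not> (s < r \<or> s = r \<and> b < a)" "\<not> (r < s \<or> r = s \<and> a < b)"
    using r s assms(2,3) unfolding available_def by auto
  with \<open>a \<noteq> b\<close> show False by linarith
qed

lemma first_selected_first_round: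
  assumes "c 1 a = Some x" "1 \<le> num_rounds M n"
  shows "first_selected M n c a = x"
proof -
  have "(LEAST r. r \<in> {1..num_rounds M n} \<and> c r a \<noteq> None) = 1"
    using assms by (intro Least_equality) auto
  then show ?thesis using assms(1) unfolding first_selected_def by simp
qed

lemma greedy_gain:
  assumes "follows_greedy M n f (cardinality_constraint M k) c i"
    and "round_robin M n c" "i \<in> {1..n}"
    and r: "r \<in> {1..num_rounds M n}" "r \<le> k"
    and x: "x \<in> available M n c r i"
  shows "marginal f (selected_before c i r) x
    \<le> f (selected_before c i (Suc r)) - f (selected_before c i r)"
proof -
  define S where "S = selected_before c i r"
  define A where "A = {x \<in> available M n c r i. S \<union> {x} \<in> cardinality_constraint M k}"
  have "S \<subseteq> M"
    using selected_before_subset_selected[of r M n c i] selected_subset[OF assms(2,3)] r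
    unfolding S_def by auto
  moreover have "finite S" "card S \<le> r - 1"
    using selected_before_finite_card unfolding S_def by auto
  \<comment> \<open>Here \<open>card (S \<union> {x}) \<le> r \<le> k\<close>, so the constraint
    does not block \<open>x\<close>.\<close>
  ultimately have "x \<in> A"
    using x r unfolding A_def cardinality_constraint_def available_def
    by (auto simp: card_insert_if)
  then have "A \<noteq> {}" by blast
  then obtain y where y: "c r i = Some y" "is_arg_max (marginal f S) (\<lambda>y. y \<in> A) y"
    using bspec[OF assms(1)[unfolded follows_greedy_def] r(1)]
    unfolding Let_def S_def[symmetric] A_def[symmetric] by auto
  \<comment> \<open>\<open>is_arg_max\<close> only says that no candidate is strictly better; the
    order on the reals is linear.\<close>
  have "marginal f S x \<le> marginal f S y"
    using y(2) \<open>x \<in> A\<close> unfolding is_arg_max_def by force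
  then show ?thesis
    using selected_before_Suc[of c r i y] y(1) r(1) by (simp add: S_def marginal_def)
qed

text \<open>The gains of \<open>i\<close> over all rounds telescope to the right-hand side, and each
  term on the left is paid for by a round of its own.\<close>

lemma greedy_sum_marginal_le:
  assumes greedy: "follows_greedy M n f (cardinality_constraint M k) c i"
    and run: "round_robin M n c" and i: "i \<in> {1..n}"
    and mono: "mono_on (Pow M) f" and sub: "submodular_on M f"
    and S: "finite S" "card S \<le> k" "S \<inter> selected M n c i = {}"
    and t: "inj_on t S" "\<And>x. x \<in> S \<Longrightarrow> t x \<in> {1..num_rounds M n}"
      "\<And>x. x \<in> S \<Longrightarrow> x \<in> available M n c (t x) i"
  shows "(\<Sum>x\<in>S. marginal f (selected M n c i) x) \<le> f (selected M n c i) - f {}"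
proof -
  let ?R = "num_rounds M n"
  define B where "B = selected_before c i"
  have BM: "B r \<subseteq> M" if "r \<le> Suc ?R" for r
    using selected_before_subset_selected[OF that] selected_subset[OF run i] unfolding B_def by blast
  define d where "d r = f (B (Suc r)) - f (B r)" for r
  have d_nonneg: "0 \<le> d r" if "r \<le> ?R" for r
    using mono_onD[OF mono, of "B r" "B (Suc r)"] BM[of r] BM[of "Suc r"] that
      selected_before_mono[of r "Suc r" c i] by (auto simp: d_def B_def)
  obtain p where p: "inj_on p S" "\<And>x. x \<in> S \<Longrightarrow> 1 \<le> p x \<and> p x \<le> card S \<and> p x \<le> t x"
    using rank_below_injection[OF S(1) t(1)] t(2) by auto
  have pR: "p x \<in> {1..?R}" if "x \<in> S" for x
    using p(2)[OF that] t(2)[OF that] by simp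
  have "marginal f (selected M n c i) x \<le> d (p x)" if x: "x \<in> S" for x
  proof -
    have av: "x \<in> available M n c (p x) i"
      using p(2)[OF x] by (intro available_earlier_turn[OF t(3)[OF x]]) auto
    have "B (p x) \<subseteq> selected M n c i"
      using pR[OF x] unfolding B_def by (intro selected_before_subset_selected) simp
    moreover have "x \<in> M" "x \<notin> selected M n c i"
      using av x S(3) unfolding available_def by auto
    \<comment> \<open>Agent \<open>i\<close> enters round \<open>p x\<close> with a subset of its
      final set, over which \<open>x\<close> is worth at least as much.\<close>
    ultimately have "marginal f (selected M n c i) x \<le> marginal f (B (p x)) x"
      using sub selected_subset[OF run i] unfolding submodular_on_def by blast
    also have "\<dots> \<le> d (p x)"
      unfolding d_def B_def using p(2)[OF x] S(2)
      by (intro greedy_gain[OF greedy run i pR[OF x] _ av]) simp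
    finally show ?thesis .
  qed
  then have "(\<Sum>x\<in>S. marginal f (selected M n c i) x) \<le> (\<Sum>x\<in>S. d (p x))"
    by (rule sum_mono)
  also have "\<dots> = sum d (p ` S)"
    using p(1) by (simp add: sum.reindex)
  \<comment> \<open>Rounds to which no item is charged add nonnegative gains, by
    monotonicity.\<close>
  also have "\<dots> \<le> sum d {1..?R}"
    using pR d_nonneg by (intro sum_mono2) auto
  also have "\<dots> = f (B (Suc ?R)) - f (B 1)"
    unfolding d_def by (rule sum_Suc_diff) simp
  also have "B 1 = {}"
    unfolding B_def selected_before_def by auto
  also have "B (Suc ?R) = selected M n c i"
    unfolding B_def by (rule selected_before_num_rounds)
  finally show ?thesis .
qed

lemma selected_slots:
  assumes run: "round_robin M n c" and j: "j \<in> {1..n}"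
    and S: "S \<subseteq> (if i < j then selected M n c j else selected M n c j - {first_selected M n c j})"
  obtains t where "inj_on t S" "\<And>x. x \<in> S \<Longrightarrow> t x \<in> {1..num_rounds M n}"
    "\<And>x. x \<in> S \<Longrightarrow> x \<in> available M n c (t x) i"
proof -
  let ?R = "num_rounds M n"
  have "S \<subseteq> selected M n c j"
    using S by (auto split: if_splits)
  then have "\<forall>x\<in>S. \<exists>r. r \<in> {1..?R} \<and> c r j = Some x"
    unfolding selected_def by blast
  then obtain rd where rd: "\<And>x. x \<in> S \<Longrightarrow> rd x \<in> {1..?R} \<and> c (rd x) j = Some x"
    by metis
  \<comment> \<open>If \<open>j\<close> moves before \<open>i\<close>, an item taken by
    \<open>j\<close> in round 1 precedes every turn of \<open>i\<close>; but that item is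
    \<open>g\<close>, which \<open>S\<close> omits.\<close>
  have late: "2 \<le> rd x" if "x \<in> S" "\<not> i < j" for x
  proof (rule ccontr)
    assume "\<not> 2 \<le> rd x"
    with rd[OF that(1)] have "rd x = 1" by auto
    then have "first_selected M n c j = x"
      using rd[OF that(1)] by (intro first_selected_first_round) auto
    then show False using that S by auto
  qed
  \<comment> \<open>The last turn of \<open>i\<close> before \<open>j\<close> takes
    \<open>x\<close>: in the same round if \<open>i < j\<close>, otherwise in the previous one,
    which exists by \<open>late\<close>.\<close>
  define t where "t x = (if i < j then rd x else rd x - 1)" for x
  \<comment> \<open>Agent \<open>j\<close> selects at most one item per round.\<close>
  have inj: "inj_on rd S"
    by (rule inj_onI) (metis option.inject rd)
  show ?thesis
  proof
    show "inj_on t S"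
    proof (rule inj_onI)
      fix x y assume xy: "x \<in> S" "y \<in> S" "t x = t y"
      then have "rd x = rd y"
        using late[of x] late[of y] by (auto simp: t_def split: if_splits)
      then show "x = y" using inj xy by (auto dest: inj_onD)
    qed
    fix x assume x: "x \<in> S"
    show "t x \<in> {1..?R}"
      using rd[OF x] late[OF x] by (auto simp: t_def)
    have "x \<in> available M n c (rd x) j"
      using run rd[OF x] j unfolding round_robin_def by blast
    then show "x \<in> available M n c (t x) i"
      by (rule available_earlier_turn) (use late[OF x] in \<open>auto simp: t_def\<close>)
  qed
qed

theorem theorem5:
  fixes M :: "'a set" and f :: "'a set \<Rightarrow> real" and n k i j :: nat and c :: "'a execution"
  assumes "finite M"
    and "i \<in> {1..n}" and "j \<in> {1..n}" and "j \<noteq> i"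
    and normalized: "f {} = 0"
    and nonnegative: "\<forall>S\<subseteq>M. 0 \<le> f S"
    and monotone: "mono_on (Pow M) f"
    and submodular: "submodular_on M f"
    and run: "round_robin M n c"
    and greedy: "follows_greedy M n f (cardinality_constraint M k) c i"
  shows "let S\<^sub>i = selected M n c i;
             S\<^sub>j = selected M n c j;
             g = first_selected M n c j;
             S\<^sub>j' = (if i < j then S\<^sub>j else S\<^sub>j - {g})
         in f S\<^sub>i \<ge> 0.5 * (MAX S \<in> constraint_restrict (cardinality_constraint M k) S\<^sub>j'. f S)"
proof -
  let ?Si = "selected M n c i"
  define Sj' where
    "Sj' = (if i < j then selected M n c j else selected M n c j - {first_selected M n c j})"
  let ?C = "constraint_restrict (cardinality_constraint M k) Sj'"
  have SiM: "?Si \<subseteq> M"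
    using selected_subset[OF run assms(2)] .
  have bound: "f S \<le> 2 * f ?Si" if SC: "S \<in> ?C" for S
  proof -
    obtain X where X: "X \<subseteq> M" "card X \<le> k" "S = X \<inter> Sj'"
      using SC unfolding constraint_restrict_def cardinality_constraint_def by blast
    have S: "S \<subseteq> M" "finite S" "S \<subseteq> Sj'"
      using X \<open>finite M\<close> by (auto intro: finite_subset)
    have "card S \<le> k"
      using X \<open>finite M\<close> by (meson card_mono finite_subset inf_le1 le_trans)
    have disj: "S \<inter> ?Si = {}"
      using selected_disjoint[OF run assms(2,3)] \<open>j \<noteq> i\<close> S(3) by (auto simp: Sj'_def split: if_splits)
    obtain t where t: "inj_on t S" "\<And>x. x \<in> S \<Longrightarrow> t x \<in> {1..num_rounds M n}"
      "\<And>x. x \<in> S \<Longrightarrow> x \<in> available M n c (t x) i"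
      by (rule selected_slots[OF run assms(3) S(3)[unfolded Sj'_def]]) blast
    \<comment> \<open>The union links the two sets: it is worth at least \<open>S\<close>, and
      exceeds \<open>?Si\<close> by at most the marginal values of \<open>S\<close> over
      \<open>?Si\<close>.\<close>
    have "f S \<le> f (?Si \<union> S)"
      using mono_onD[OF monotone, of S "?Si \<union> S"] S(1) SiM by auto
    also have "\<dots> \<le> f ?Si + (\<Sum>x\<in>S. marginal f ?Si x)"
      using submodular_on_union_le[OF submodular S(2) SiM S(1)] disj by (simp add: Int_commute)
    also have "\<dots> \<le> 2 * f ?Si"
      using greedy_sum_marginal_le[OF greedy run assms(2) monotone submodular S(2) \<open>card S \<le> k\<close> disj t]
        normalized by simp
    finally show ?thesis .
  qed
  have "?C \<subseteq> Pow M"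
    unfolding constraint_restrict_def cardinality_constraint_def by auto
  then have "finite ?C"
    using \<open>finite M\<close> by (meson finite_Pow_iff finite_subset)
  \<comment> \<open>The maximum needs a finite nonempty set; \<open>X = {}\<close> gives a member
    for every \<open>k\<close> and \<open>Sj'\<close>.\<close>
  moreover have "{} \<in> ?C"
    unfolding constraint_restrict_def cardinality_constraint_def by force
  ultimately have "(MAX S \<in> ?C. f S) \<le> 2 * f ?Si"
    using bound by (intro Max.boundedI) auto
  then show ?thesis
    unfolding Let_def Sj'_def by simp
qed

end
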